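(* Let $\lambda>0$ and let $\{z_k\}_{k\ge0}$ be generated from $z_0\in\mathcal H$ by the Halpern iteration $z_{k+1}=\frac{1}{k+2}z_0+\frac{k+1}{k+2}Nz_k$ ($k\ge0$) with $N=J_{T_\lambda}=(I+T_\lambda)^{-1}$. Then the iteration of the points $J_{T_\lambda}(z_{k+1})$ is equivalent to the Contracting PPA (defined in the context) with $g_k\equiv0$, $a_k\equiv1$, $A_0=1$ and $A_0T_\lambda(x_0)+v_0=z_0$; that is, the sequence $\{x_k\}$ generated by the Contracting PPA with these parameters satisfies $x_{k+1}=J_{T_\lambda}(z_{k+1})$ for all $k\ge0$.
   Context: $\mathcal H$ is a real Hilbert space. $T$ is a (set-valued) maximally monotone operator on $\mathcal H$ such that $T^{-1}(0)=\{x:0\in Tx\}$ is nonempty and bounded. For $\lambda>0$, $J_{\lambda T}=(I+\lambda T)^{-1}$, $T_\lambda=\frac1\lambda(I-J_{\lambda T})$ is the (single-valued) Yosida regularization, and $J_{\mu T_\lambda}=(I+\mu T_\lambda)^{-1}$ for $\mu>0$. Contracting PPA: given $\varepsilon>0$, $a_0>0$, $a_{k+1}\ge\varepsilon$ ($k\ge0$), $x_{-1}=x_0\in\mathcal H$, $A_{-1}=0$, set for all $k\ge 0$ $$A_k=a_k+A_{k-1},\qquad v_k=\frac{A_kx_k-A_{k-1}x_{k-1}}{a_k}.$$ For given $\delta_k\ge0$ with $\sum_{k\ge0}\delta_k<+\infty$, for $k=0,1,\dots$ find $x_{k+1}$ such that $$0=A_{k+1}T_\lambda(x_{k+1})-A_kT_\lambda(x_k)+v_{k+1}-v_k+g_k,$$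 where $g_k\in\mathcal H$ satisfies $\|g_k\|\le\delta_k$. (With $a_k\equiv 1$ one has $A_k=k+1$, $v_0=x_0$.) *)

theory Defs
  imports "HOL-Analysis.Analysis"
begin

text \<open>Set-valued operators on \<open>'a\<close> are functions \<open>'a \<Rightarrow> 'a set\<close>.\<close>

definition monotone_operator :: "('a::real_inner \<Rightarrow> 'a set) \<Rightarrow> bool" where
  "monotone_operator T \<longleftrightarrow> (\<forall>x y. \<forall>u\<in>T x. \<forall>v\<in>T y. 0 \<le> inner (x - y) (u - v))"

definition maximally_monotone :: "('a::real_inner \<Rightarrow> 'a set) \<Rightarrow> bool" where
  "maximally_monotone T \<longleftrightarrow> monotone_operator T \<and>
     (\<forall>S. monotone_operator S \<and> (\<forall>x. T x \<subseteq> S x) \<longrightarrow> S = T)"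

definition inverse_operator :: "('a \<Rightarrow> 'a set) \<Rightarrow> 'a \<Rightarrow> 'a set" where
  "inverse_operator T y = {x. y \<in> T x}"

definition id_plus :: "real \<Rightarrow> ('a::real_vector \<Rightarrow> 'a set) \<Rightarrow> 'a \<Rightarrow> 'a set" where
  "id_plus c T x = {x + c *\<^sub>R u | u. u \<in> T x}"

text \<open>The resolvent \<open>(I + c T)\<inverse>\<close> as a function. The description is meaningful when the
  set-valued inverse is a singleton at every point, which holds for maximally monotone
  \<open>T\<close> on a Hilbert space and \<open>c > 0\<close> (Minty).\<close>

definition resolvent :: "real \<Rightarrow> ('a::real_vector \<Rightarrow> 'a set) \<Rightarrow> 'a \<Rightarrow> 'a" where
  "resolvent c T x = (THE y. y \<in> inverse_operator (id_plus c T) x)"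

definition yosida :: "real \<Rightarrow> ('a::real_vector \<Rightarrow> 'a set) \<Rightarrow> 'a \<Rightarrow> 'a" where
  "yosida l T x = (1 / l) *\<^sub>R (x - resolvent l T x)"

definition yosida_resolvent :: "real \<Rightarrow> real \<Rightarrow> ('a::real_vector \<Rightarrow> 'a set) \<Rightarrow> 'a \<Rightarrow> 'a" where
  "yosida_resolvent m l T = resolvent m (\<lambda>x. {yosida l T x})"

definition halpern_iteration :: "('a::real_vector \<Rightarrow> 'a) \<Rightarrow> (nat \<Rightarrow> 'a) \<Rightarrow> bool" where
  "halpern_iteration N z \<longleftrightarrow>
     (\<forall>k. z (Suc k) = (1 / (real k + 2)) *\<^sub>R z 0 + ((real k + 1) / (real k + 2)) *\<^sub>R N (z k))"

definition cppa_A :: "(nat \<Rightarrow> real) \<Rightarrow> nat \<Rightarrow> real" where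
  "cppa_A a k = (\<Sum>i\<le>k. a i)"

text \<open>The sum over \<open>i < k\<close> is \<open>A\<close> at index \<open>k - 1\<close>; it is \<open>0\<close> for \<open>k = 0\<close>, matching the
  convention that \<open>A\<close> vanishes at index \<open>-1\<close>. For \<open>k = 0\<close> truncated subtraction makes
  \<open>x (k - 1) = x 0\<close>, matching the convention that \<open>x\<close> at index \<open>-1\<close> is \<open>x 0\<close>.\<close>

definition cppa_v :: "(nat \<Rightarrow> real) \<Rightarrow> (nat \<Rightarrow> 'a::real_vector) \<Rightarrow> nat \<Rightarrow> 'a" where
  "cppa_v a x k = (1 / a k) *\<^sub>R (cppa_A a k *\<^sub>R x k - (\<Sum>i<k. a i) *\<^sub>R x (k - 1))"

definition cppa_parameters ::
    "real \<Rightarrow> (nat \<Rightarrow> real) \<Rightarrow> (nat \<Rightarrow> real) \<Rightarrow> (nat \<Rightarrow> 'a::real_normed_vector) \<Rightarrow> bool" where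
  "cppa_parameters \<epsilon> a \<delta> g \<longleftrightarrow>
     0 < \<epsilon> \<and> 0 < a 0 \<and> (\<forall>k. \<epsilon> \<le> a (Suc k)) \<and>
     (\<forall>k. 0 \<le> \<delta> k) \<and> summable \<delta> \<and> (\<forall>k. norm (g k) \<le> \<delta> k)"

definition contracting_ppa ::
    "(nat \<Rightarrow> real) \<Rightarrow> (nat \<Rightarrow> 'a) \<Rightarrow> real \<Rightarrow> ('a::real_vector \<Rightarrow> 'a set) \<Rightarrow> (nat \<Rightarrow> 'a) \<Rightarrow> bool" where
  "contracting_ppa a g l T x \<longleftrightarrow>
     (\<forall>k. 0 = cppa_A a (Suc k) *\<^sub>R yosida l T (x (Suc k)) - cppa_A a k *\<^sub>R yosida l T (x k)
            + cppa_v a x (Suc k) - cppa_v a x k + g k)"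

end

theory Submission
  imports Defs
begin

text \<open>Write \<open>Y\<close> for the Yosida regularization and \<open>N = (I + Y)\<inverse>\<close>. The Contracting PPA without
  errors says that \<open>A\<^sub>k Y x\<^sub>k + v\<^sub>k\<close> does not depend on \<open>k\<close>, so this quantity keeps its initial
  value \<open>z\<^sub>0\<close>. With unit weights \<open>A\<^sub>k = k + 1\<close> and \<open>v\<^sub>k = (k + 1) x\<^sub>k - k x\<^bsub>k-1\<^esub>\<close>, so the conserved
  quantity gives
  \<open>x\<^sub>k + Y x\<^sub>k = z\<^sub>0 / (k + 1) + (k / (k + 1)) x\<^bsub>k-1\<^esub>\<close>. If \<open>x\<^bsub>k-1\<^esub> = N z\<^bsub>k-1\<^esub>\<close>, the right-hand side is
  the Halpern point \<open>z\<^sub>k\<close>, and the equation reads \<open>x\<^sub>k = N z\<^sub>k\<close>; the case \<open>k = 0\<close> is the assumption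
  on the starting point. Both directions of the equivalence follow by comparing the two recursions.

  The reading of \<open>x + Y x = w\<close> as \<open>x = N w\<close> is where the analysis lies. It needs that
  \<open>I + Y\<close> is a bijection (lemma \<open>yosida_resolvent_eq_iff\<close>), although resolvents are given only by
  definite descriptions. This rests on Minty's theorem (lemma \<open>minty\<close>): \<open>I + c T\<close> is onto.
  Minty's theorem is derived here from the Fitzpatrick function of \<open>T\<close>, the supremum
  of the affine functions \<open>(x, u) \<mapsto> \<langle>x, v\<rangle> + \<langle>y, u\<rangle> - \<langle>y, v\<rangle>\<close> over the graph points \<open>(y, v)\<close>.
  Adding half the squared norm makes it strongly convex, so minimizing
  sequences are Cauchy and a minimizer exists by completeness; the optimality condition there,
  combined with maximality, produces a solution of the inclusion.\<close>

section \<open>Strongly convex minimization over an epigraph\<close>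

text \<open>A convex lower semicontinuous function is represented by its epigraph, a closed convex set
  of pairs \<open>(x, t)\<close>, which avoids extended real values. The objective is half a squared
  norm plus an affine term, so the parallelogram law makes every minimizing sequence
  Cauchy. The conclusion says that \<open>- fst p\<close> is a subgradient at the minimizer \<open>p\<close>.\<close>

lemma epigraph_regularized_minimizer:
  fixes C :: "('b::{real_inner, complete_space} \<times> real) set"
  assumes "closed C" "convex C" "C \<noteq> {}"
    and bound: "\<And>q. q \<in> C \<Longrightarrow> b \<le> snd q + (norm (fst q))\<^sup>2 / 2"
  obtains p where "p \<in> C"
    and "\<And>q. q \<in> C \<Longrightarrow> snd p - inner (fst p) (fst q - fst p) \<le> snd q"
proof -
  define \<phi> where "\<phi> q = snd q + (norm (fst q))\<^sup>2 / 2" for q :: "'b \<times> real"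
  define m where "m = Inf (\<phi> ` C)"
  have bdd: "bdd_below (\<phi> ` C)"
    using bound unfolding \<phi>_def by (intro bdd_belowI[where m = b]) auto
  have m_le: "m \<le> \<phi> q" if "q \<in> C" for q
    unfolding m_def using bdd that by (intro cInf_lower) auto
  have "\<exists>q\<in>C. \<phi> q < m + inverse (real (Suc n))" for n
  proof -
    have "Inf (\<phi> ` C) < m + inverse (real (Suc n))"
      unfolding m_def by simp
    then show ?thesis
      using \<open>C \<noteq> {}\<close> bdd by (subst (asm) cInf_less_iff) auto
  qed
  then obtain s where s_in: "\<And>n. s n \<in> C"
    and s_lt: "\<And>n. \<phi> (s n) < m + inverse (real (Suc n))"
    by metis
  \<comment> \<open>compare the infimum with the value at the midpoint, which strong convexity lowers by an
    eighth of the squared distance\<close>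
  have dist_le: "(norm (fst p - fst q))\<^sup>2 \<le> 4 * (\<phi> p + \<phi> q - 2 * m)" if "p \<in> C" "q \<in> C" for p q
  proof -
    have "(1/2) *\<^sub>R p + (1/2) *\<^sub>R q \<in> C"
      using \<open>convex C\<close> that by (intro convexD) auto
    then have "m \<le> \<phi> ((1/2) *\<^sub>R p + (1/2) *\<^sub>R q)" by (rule m_le)
    also have "\<dots> = \<phi> p / 2 + \<phi> q / 2 - (norm (fst p - fst q))\<^sup>2 / 8"
      unfolding \<phi>_def power2_norm_eq_inner
      by (simp add: algebra_simps inner_commute field_simps)
    finally show ?thesis by simp
  qed
  have "Cauchy (\<lambda>n. fst (s n))"
  proof (rule metric_CauchyI)
    fix e :: real assume "e > 0"
    then obtain M where M: "inverse (real (Suc M)) < e\<^sup>2 / 8"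
      using reals_Archimedean[of "e\<^sup>2 / 8"] by auto
    have small: "\<phi> (s n) - m < e\<^sup>2 / 8" if "n \<ge> M" for n
    proof -
      have "inverse (real (Suc n)) \<le> inverse (real (Suc M))"
        using that by simp
      then show ?thesis using s_lt[of n] M by linarith
    qed
    have "dist (fst (s i)) (fst (s j)) < e" if "i \<ge> M" "j \<ge> M" for i j
    proof -
      have "(norm (fst (s i) - fst (s j)))\<^sup>2 < e\<^sup>2"
        using dist_le[OF s_in[of i] s_in[of j]] small[OF that(1)] small[OF that(2)]
        by argo
      then show ?thesis
        using \<open>e > 0\<close> by (auto simp: dist_norm intro: power2_less_imp_less)
    qed
    then show "\<exists>M. \<forall>i\<ge>M. \<forall>j\<ge>M. dist (fst (s i)) (fst (s j)) < e" by blast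
  qed
  then obtain x where x: "(\<lambda>n. fst (s n)) \<longlonglongrightarrow> x"
    using Cauchy_convergent_iff convergent_def by blast
  have \<phi>_lim: "(\<lambda>n. \<phi> (s n)) \<longlonglongrightarrow> m"
  proof (rule tendsto_sandwich)
    show "\<forall>\<^sub>F n in sequentially. m \<le> \<phi> (s n)" using m_le s_in by simp
    show "\<forall>\<^sub>F n in sequentially. \<phi> (s n) \<le> m + inverse (real (Suc n))"
      using s_lt by (simp add: less_imp_le)
    show "(\<lambda>n. m + inverse (real (Suc n))) \<longlonglongrightarrow> m"
      using tendsto_add[OF tendsto_const LIMSEQ_inverse_real_of_nat, of m] by simp
  qed simp
  define p where "p = (x, m - (norm x)\<^sup>2 / 2)"
  have "(\<lambda>n. (fst (s n), \<phi> (s n) - (norm (fst (s n)))\<^sup>2 / 2)) \<longlonglongrightarrow> p"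
    unfolding p_def by (intro tendsto_intros x \<phi>_lim) simp
  moreover have "(fst (s n), \<phi> (s n) - (norm (fst (s n)))\<^sup>2 / 2) = s n" for n
    by (simp add: \<phi>_def)
  ultimately have "s \<longlonglongrightarrow> p" by simp
  then have p_in: "p \<in> C"
    using \<open>closed C\<close> s_in closed_sequentially by blast
  have \<phi>_p: "\<phi> p = m" by (simp add: \<phi>_def p_def)
  have "snd p - inner (fst p) (fst q - fst p) \<le> snd q" if q: "q \<in> C" for q
  proof -
    define d where "d = snd q - snd p + inner (fst p) (fst q - fst p)"
    define r where "r = (norm (fst q - fst p))\<^sup>2 / 2"
    \<comment> \<open>minimality along the segment from \<open>p\<close> to \<open>q\<close>; the quadratic remainder vanishes as \<open>t\<close>
      tends to zero\<close>
    have slope: "0 \<le> d + t * r" if t: "0 < t" "t \<le> 1" for t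
    proof -
      have "(1 - t) *\<^sub>R p + t *\<^sub>R q \<in> C"
        using \<open>convex C\<close> p_in q t by (intro convexD) auto
      then have "\<phi> p \<le> \<phi> ((1 - t) *\<^sub>R p + t *\<^sub>R q)" using m_le \<phi>_p by simp
      also have "\<dots> = \<phi> p + t * (d + t * r)"
        unfolding \<phi>_def d_def r_def power2_norm_eq_inner
        by (simp add: algebra_simps inner_commute field_simps)
      finally show ?thesis using t by (simp add: zero_le_mult_iff)
    qed
    have "((\<lambda>t. d + t * r) \<longlongrightarrow> d + 0 * r) (at_right 0)"
      by (intro tendsto_intros)
    moreover have "\<forall>\<^sub>F t in at_right 0. 0 \<le> d + t * r"
      using eventually_at_right_real[of 0 "1::real"]
      by (auto elim!: eventually_mono intro: slope)
    ultimately have "0 \<le> d + 0 * r"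
      by (rule tendsto_lowerbound) simp
    then show ?thesis by (simp add: d_def)
  qed
  with p_in show thesis by (rule that)
qed

section \<open>Minty's theorem\<close>

lemma monotone_operatorD:
  "monotone_operator T \<Longrightarrow> u \<in> T x \<Longrightarrow> v \<in> T y \<Longrightarrow> 0 \<le> inner (x - y) (u - v)"
  unfolding monotone_operator_def by blast

text \<open>Maximality in the form in which it is used: adding a monotonically related point to the graph
  keeps the operator monotone, so the point was there already.\<close>

lemma maximally_monotone_mem:
  assumes "maximally_monotone T"
    and rel: "\<And>y v. v \<in> T y \<Longrightarrow> 0 \<le> inner (x - y) (u - v)"
  shows "u \<in> T x"
proof -
  define S where "S = T(x := insert u (T x))"
  have mono: "monotone_operator T"
    using assms(1) by (simp add: maximally_monotone_def)
  have rel': "0 \<le> inner (y - x) (v - u)" if "v \<in> T y" for y v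
    using rel[OF that] by (simp add: algebra_simps)
  have "monotone_operator S"
    unfolding monotone_operator_def S_def
    using rel rel' monotone_operatorD[OF mono] by (auto split: if_splits)
  moreover have "\<forall>y. T y \<subseteq> S y" by (auto simp: S_def)
  ultimately have "S = T"
    using assms(1) unfolding maximally_monotone_def by blast
  moreover have "u \<in> S x" by (simp add: S_def)
  ultimately show ?thesis by simp
qed

text \<open>The regularized Fitzpatrick function is bounded below by
  \<open>\<parallel>x + u\<parallel>\<^sup>2 / 2\<close>, hence has a minimizer \<open>(x, u)\<close>. On the graph the Fitzpatrick function is the
  pairing \<open>\<langle>y, v\<rangle>\<close>; inserting this in the subgradient inequality shows that \<open>(- u, - x)\<close> is
  monotonically related to the graph, with a surplus of \<open>\<parallel>x + u\<parallel>\<^sup>2\<close>. By maximality this is itself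
  a graph point, and testing it against itself forces \<open>u = - x\<close>.
  The operator is given by a predicate closed under monotonically related points, because affine
  changes of variable preserve that property in an evident way.\<close>

lemma minty_at_zero:
  fixes G :: "'a::{real_inner, complete_space} \<Rightarrow> 'a \<Rightarrow> bool"
  assumes mono: "\<And>x u y v. G x u \<Longrightarrow> G y v \<Longrightarrow> 0 \<le> inner (x - y) (u - v)"
    and max: "\<And>x u. (\<And>y v. G y v \<Longrightarrow> 0 \<le> inner (x - y) (u - v)) \<Longrightarrow> G x u"
  shows "\<exists>x. G x (- x)"
proof -
  define H where "H y v = {q :: ('a \<times> 'a) \<times> real. inner ((v, y), -1) q \<le> inner y v}" for y v
  \<comment> \<open>the epigraph of the Fitzpatrick function\<close>
  define C where "C = (\<Inter>(y, v)\<in>{(y, v). G y v}. H y v)"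
  have C_iff: "((x, u), t) \<in> C \<longleftrightarrow> (\<forall>y v. G y v \<longrightarrow> inner x v + inner y u - inner y v \<le> t)"
    for x u t
    by (auto simp: C_def H_def inner_prod_def inner_commute algebra_simps)
  have closed: "closed C"
    unfolding C_def H_def by (intro closed_INT) (auto simp: closed_halfspace_le)
  have convex: "convex C"
    unfolding C_def H_def by (intro convex_INT) (auto simp: convex_halfspace_le)
  have graph: "((y, v), inner y v) \<in> C" if "G y v" for y v
    unfolding C_iff using mono[OF that] by (auto simp: algebra_simps inner_commute)
  have above: "inner x u \<le> t" if q: "((x, u), t) \<in> C" for x u t
  proof (rule ccontr)
    assume less: "\<not> inner x u \<le> t"
    have "G x u"
    proof (rule max)
      fix y v assume "G y v"
      then have "inner x v + inner y u - inner y v \<le> t" using q C_iff by blast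
      then show "0 \<le> inner (x - y) (u - v)" using less by (simp add: algebra_simps)
    qed
    then have "inner x u + inner x u - inner x u \<le> t" using q C_iff by blast
    then show False using less by simp
  qed
  have bound: "0 \<le> snd q + (norm (fst q))\<^sup>2 / 2" if "q \<in> C" for q
  proof -
    obtain x u t where q: "q = ((x, u), t)" by (metis surj_pair)
    have "0 \<le> inner (x + u) (x + u) / 2" by simp
    also have "\<dots> = inner x u + (norm (x, u))\<^sup>2 / 2"
      by (simp add: power2_norm_eq_inner inner_prod_def algebra_simps inner_commute field_simps)
    finally show ?thesis using above that by (force simp: q)
  qed
  \<comment> \<open>an empty graph would make every point monotonically related to it\<close>
  have "\<exists>y v. G y v" using max by blast
  then have "C \<noteq> {}" using graph by blast
  then obtain p where p: "p \<in> C"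
    and sub: "\<And>q. q \<in> C \<Longrightarrow> snd p - inner (fst p) (fst q - fst p) \<le> snd q"
    using epigraph_regularized_minimizer[OF closed convex _ bound] by blast
  obtain x u t where p_eq: "p = ((x, u), t)" by (metis surj_pair)
  have surplus: "inner (x + u) (x + u) \<le> inner (- u - y) (- x - v)" if "G y v" for y v
  proof -
    have "t - (inner x (y - x) + inner u (v - u)) \<le> inner y v"
      using sub[OF graph[OF that]] by (simp add: p_eq inner_prod_def)
    moreover have "inner x u \<le> t" using above p p_eq by blast
    ultimately show ?thesis by (simp add: algebra_simps inner_commute)
  qed
  have refl: "G (- u) (- x)"
    using surplus inner_ge_zero order_trans by (intro max) blast
  have "inner (x + u) (x + u) \<le> 0" using surplus[OF refl] by simp
  then have "x + u = 0" by (metis inner_ge_zero inner_eq_zero_iff order_antisym)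
  then have "- u = x" by (simp add: add_eq_0_iff2)
  then show ?thesis using refl by auto
qed

text \<open>The inclusion \<open>w \<in> x + c T x\<close> is the inclusion at zero for the maximally monotone operator
  \<open>c T - w\<close>.\<close>

theorem minty:
  fixes T :: "'a::{real_inner, complete_space} \<Rightarrow> 'a set"
  assumes T: "maximally_monotone T" and c: "c > 0"
  shows "\<exists>x. (1 / c) *\<^sub>R (w - x) \<in> T x"
proof -
  define G where "G x u \<longleftrightarrow> (1 / c) *\<^sub>R (w + u) \<in> T x" for x u
  have scale: "inner (x - y) ((1 / c) *\<^sub>R (w + u) - (1 / c) *\<^sub>R (w + v))
      = inner (x - y) (u - v) / c" for x y u v
    by (simp add: inner_diff_right inner_add_right diff_divide_distrib add_divide_distrib)
  have "\<exists>x. G x (- x)"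
  proof (rule minty_at_zero)
    fix x u y v assume "G x u" "G y v"
    moreover have "monotone_operator T" using T by (simp add: maximally_monotone_def)
    ultimately have "0 \<le> inner (x - y) (u - v) / c"
      unfolding G_def by (metis monotone_operatorD scale)
    then show "0 \<le> inner (x - y) (u - v)" using c by (simp add: zero_le_divide_iff)
  next
    fix x u assume rel: "\<And>y v. G y v \<Longrightarrow> 0 \<le> inner (x - y) (u - v)"
    show "G x u"
      unfolding G_def
    proof (rule maximally_monotone_mem[OF T])
      fix y v assume "v \<in> T y"
      then have "G y (c *\<^sub>R v - w)" using c by (simp add: G_def)
      then have "0 \<le> inner (x - y) (u - (c *\<^sub>R v - w)) / c"
        using rel c by simp
      then show "0 \<le> inner (x - y) ((1 / c) *\<^sub>R (w + u) - v)"
        using c scale[of x y u "c *\<^sub>R v - w"] by simp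
    qed
  qed
  then show ?thesis by (auto simp: G_def)
qed

section \<open>Resolvents and the Yosida regularization\<close>

lemma the_eq_iff: "\<exists>!y. P y \<Longrightarrow> (THE y. P y) = y \<longleftrightarrow> P y"
  by (blast intro: the1_equality theI')

lemma mem_inverse_id_plus_iff:
  assumes "c \<noteq> 0"
  shows "y \<in> inverse_operator (id_plus c T) w \<longleftrightarrow> (1 / c) *\<^sub>R (w - y) \<in> T y"
  using assms unfolding inverse_operator_def id_plus_def
  by (force intro: exI[where x = "(1 / c) *\<^sub>R (w - y)"])

text \<open>Monotonicity makes the resolvent single-valued, Minty's theorem makes it total; together
  they turn the definite description into a characterization.\<close>

lemma resolvent_eq_iff:
  fixes T :: "'a::{real_inner, complete_space} \<Rightarrow> 'a set"
  assumes T: "maximally_monotone T" and c: "c > 0"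
  shows "resolvent c T w = y \<longleftrightarrow> (1 / c) *\<^sub>R (w - y) \<in> T y"
proof -
  have unique: "x = y" if "(1 / c) *\<^sub>R (w - x) \<in> T x" "(1 / c) *\<^sub>R (w - y) \<in> T y" for x y
  proof -
    have "0 \<le> inner (x - y) ((1 / c) *\<^sub>R (w - x) - (1 / c) *\<^sub>R (w - y))"
      using T that by (auto simp: maximally_monotone_def intro: monotone_operatorD)
    also have "\<dots> = - inner (x - y) (x - y) / c"
      by (simp add: inner_diff_right inner_add_right diff_divide_distrib add_divide_distrib)
    finally have "inner (x - y) (x - y) \<le> 0"
      using c by (simp add: divide_le_0_iff)
    then show ?thesis by (metis inner_ge_zero inner_eq_zero_iff order_antisym eq_iff_diff_eq_0)
  qed
  have "\<exists>!y. (1 / c) *\<^sub>R (w - y) \<in> T y"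
    using minty[OF T c] unique by blast
  note the_eq_iff[OF this, of y]
  moreover have "resolvent c T w = (THE y. (1 / c) *\<^sub>R (w - y) \<in> T y)"
    using c by (simp add: resolvent_def mem_inverse_id_plus_iff)
  ultimately show ?thesis by (simp only:)
qed

lemma yosida_mem:
  fixes T :: "'a::{real_inner, complete_space} \<Rightarrow> 'a set"
  assumes "maximally_monotone T" "l > 0"
  shows "yosida l T x \<in> T (resolvent l T x)"
  using resolvent_eq_iff[OF assms] unfolding yosida_def by blast

text \<open>Decompose \<open>x = J x + l Y x\<close> with \<open>Y x \<in> T (J x)\<close>: the first part contributes the monotonicity
  of \<open>T\<close>, the second a square.\<close>

lemma yosida_monotone:
  fixes T :: "'a::{real_inner, complete_space} \<Rightarrow> 'a set"
  assumes T: "maximally_monotone T" and l: "l > 0"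
  shows "0 \<le> inner (x - y) (yosida l T x - yosida l T y)"
proof -
  let ?J = "resolvent l T" and ?Y = "yosida l T"
  have decomp: "x = ?J x + l *\<^sub>R ?Y x" for x
    using l by (simp add: yosida_def)
  have "x - y = (?J x - ?J y) + l *\<^sub>R (?Y x - ?Y y)"
    using decomp[of x] decomp[of y] by (simp add: algebra_simps)
  then have "inner (x - y) (?Y x - ?Y y)
      = inner (?J x - ?J y) (?Y x - ?Y y) + l * inner (?Y x - ?Y y) (?Y x - ?Y y)"
    by (simp only: inner_add_left inner_scaleR_left)
  moreover have "0 \<le> inner (?J x - ?J y) (?Y x - ?Y y)"
    using T yosida_mem[OF T l] by (auto simp: maximally_monotone_def intro: monotone_operatorD)
  ultimately show ?thesis using l by simp
qed

text \<open>Uniqueness comes from the monotonicity of the Yosida regularization. The solution itself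
  comes from Minty's theorem for \<open>T\<close> with parameter \<open>l + m\<close>: if \<open>j + (l + m) u = w\<close> with
  \<open>u \<in> T j\<close>, then \<open>y = j + l u\<close> has resolvent \<open>j\<close> and Yosida value \<open>u\<close>, so \<open>y + m u = w\<close>.\<close>

lemma yosida_resolvent_eq_iff:
  fixes T :: "'a::{real_inner, complete_space} \<Rightarrow> 'a set"
  assumes T: "maximally_monotone T" and l: "l > 0" and m: "m > 0"
  shows "yosida_resolvent m l T w = y \<longleftrightarrow> y + m *\<^sub>R yosida l T y = w"
proof -
  let ?Y = "yosida l T"
  have unique: "x = y" if "x + m *\<^sub>R ?Y x = y + m *\<^sub>R ?Y y" for x y
  proof -
    have "x - y = - m *\<^sub>R (?Y x - ?Y y)" using that by (simp add: algebra_simps)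
    then have "inner (x - y) (x - y) = - m * inner (x - y) (?Y x - ?Y y)"
      by (metis inner_scaleR_right)
    also have "\<dots> \<le> 0" using yosida_monotone[OF T l] m by simp
    finally show ?thesis by (metis inner_ge_zero inner_eq_zero_iff order_antisym eq_iff_diff_eq_0)
  qed
  have "\<exists>y. y + m *\<^sub>R ?Y y = w"
  proof -
    obtain j where j: "(1 / (l + m)) *\<^sub>R (w - j) \<in> T j"
      using minty[OF T, of "l + m" w] l m by auto
    define u where "u = (1 / (l + m)) *\<^sub>R (w - j)"
    have "resolvent l T (j + l *\<^sub>R u) = j"
      using j l by (simp add: resolvent_eq_iff[OF T l] u_def)
    then have "?Y (j + l *\<^sub>R u) = u" using l by (simp add: yosida_def)
    then have "j + l *\<^sub>R u + m *\<^sub>R ?Y (j + l *\<^sub>R u) = j + (l + m) *\<^sub>R u"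
      by (simp add: scaleR_add_left)
    also have "\<dots> = w" using l m by (simp add: u_def)
    finally show ?thesis by blast
  qed
  then have ex1: "\<exists>!y. y + m *\<^sub>R ?Y y = w" using unique by metis
  have "y \<in> inverse_operator (id_plus m (\<lambda>x. {?Y x})) w \<longleftrightarrow> y + m *\<^sub>R ?Y y = w" for y
    by (auto simp: inverse_operator_def id_plus_def)
  then have "yosida_resolvent m l T w = (THE y. y + m *\<^sub>R ?Y y = w)"
    by (simp add: yosida_resolvent_def resolvent_def)
  then show ?thesis using the_eq_iff[OF ex1, of y] by (simp only:)
qed

section \<open>The Contracting PPA as a Halpern iteration\<close>

text \<open>Summing the error-free Contracting PPA telescopes.\<close>

lemma contracting_ppa_conserved_iff:
  "contracting_ppa a (\<lambda>k. 0) l T x \<longleftrightarrow>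
    (\<forall>k. cppa_A a k *\<^sub>R yosida l T (x k) + cppa_v a x k
       = cppa_A a 0 *\<^sub>R yosida l T (x 0) + cppa_v a x 0)"
proof -
  define E where "E k = cppa_A a k *\<^sub>R yosida l T (x k) + cppa_v a x k" for k
  have "contracting_ppa a (\<lambda>k. 0) l T x \<longleftrightarrow> (\<forall>k. E (Suc k) = E k)"
    unfolding contracting_ppa_def E_def by (auto simp: algebra_simps eq_diff_eq)
  also have "\<dots> \<longleftrightarrow> (\<forall>k. E k = E 0)"
  proof
    assume step: "\<forall>k. E (Suc k) = E k"
    have "E k = E 0" for k by (induction k) (use step in simp_all)
    then show "\<forall>k. E k = E 0" by simp
  qed metis
  finally show ?thesis by (simp add: E_def)
qed

text \<open>With unit weights, dividing the conserved quantity by \<open>A\<^bsub>k+1\<^esub> = k + 2\<close> exposes the Halpern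
  average of the anchor \<open>w\<close> and the previous iterate.\<close>

lemma unit_weight_conserved_iff:
  "cppa_A (\<lambda>k. 1) (Suc k) *\<^sub>R y + cppa_v (\<lambda>k. 1) x (Suc k) = w \<longleftrightarrow>
    x (Suc k) + y = (1 / (real k + 2)) *\<^sub>R w + ((real k + 1) / (real k + 2)) *\<^sub>R x k"
  (is "?L = w \<longleftrightarrow> ?s = ?r")
proof -
  have "?L = w \<longleftrightarrow> (real k + 2) *\<^sub>R ?s = w + (real k + 1) *\<^sub>R x k"
    by (auto simp: cppa_A_def cppa_v_def algebra_simps)
  also have "w + (real k + 1) *\<^sub>R x k = (real k + 2) *\<^sub>R ?r"
    by (simp add: scaleR_add_right)
  also have "(real k + 2) *\<^sub>R ?s = (real k + 2) *\<^sub>R ?r \<longleftrightarrow> ?s = ?r"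
    by (subst scaleR_cancel_left) auto
  finally show ?thesis .
qed

theorem theorem3:
  fixes T :: "'a::{real_inner, complete_space} \<Rightarrow> 'a set"
    and l \<epsilon> :: real
    and a \<delta> :: "nat \<Rightarrow> real"
    and g x z :: "nat \<Rightarrow> 'a"
  assumes "maximally_monotone T"
    and "inverse_operator T 0 \<noteq> {}"
    and "bounded (inverse_operator T 0)"
    and "l > 0"
    and "halpern_iteration (yosida_resolvent 1 l T) z"
    and "a = (\<lambda>k. 1)"
    and "g = (\<lambda>k. 0)"
    and "cppa_parameters \<epsilon> a \<delta> g"
    and "cppa_A a 0 = 1"
    and "cppa_A a 0 *\<^sub>R yosida l T (x 0) + cppa_v a x 0 = z 0"
  shows "contracting_ppa a g l T x \<longleftrightarrow>
         (\<forall>k. x (Suc k) = yosida_resolvent 1 l T (z (Suc k)))"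
proof -
  let ?Y = "yosida l T" and ?N = "yosida_resolvent 1 l T"
  have N_iff: "?N w = y \<longleftrightarrow> y + ?Y y = w" for w y
    using yosida_resolvent_eq_iff[OF assms(1,4), of 1] by simp
  have start: "x 0 = ?N (z 0)"
    using assms(6,10) N_iff[of "z 0" "x 0"] by (simp add: cppa_A_def cppa_v_def add.commute)
  have halpern: "z (Suc k) = (1 / (real k + 2)) *\<^sub>R z 0 + ((real k + 1) / (real k + 2)) *\<^sub>R ?N (z k)"
    for k
    using assms(5) by (simp add: halpern_iteration_def)
  have "contracting_ppa a g l T x \<longleftrightarrow>
      (\<forall>k. cppa_A a k *\<^sub>R ?Y (x k) + cppa_v a x k = z 0)"
    using assms(7,10) by (simp add: contracting_ppa_conserved_iff)
  also have "\<dots> \<longleftrightarrow> (\<forall>k. cppa_A a (Suc k) *\<^sub>R ?Y (x (Suc k)) + cppa_v a x (Suc k) = z 0)"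
    using assms(10) by (metis not0_implies_Suc)
  also have "\<dots> \<longleftrightarrow> (\<forall>k. x (Suc k) + ?Y (x (Suc k))
      = (1 / (real k + 2)) *\<^sub>R z 0 + ((real k + 1) / (real k + 2)) *\<^sub>R x k)" (is "_ \<longleftrightarrow> ?rec")
    by (simp only: assms(6) unit_weight_conserved_iff)
  also have "\<dots> \<longleftrightarrow> (\<forall>k. x (Suc k) = ?N (z (Suc k)))"
  proof
    assume rec: ?rec
    have all: "x k = ?N (z k)" for k
    proof (induction k)
      case (Suc k)
      then have "x (Suc k) + ?Y (x (Suc k)) = z (Suc k)" using rec halpern[of k] by simp
      then show ?case using N_iff by metis
    qed (rule start)
    show "\<forall>k. x (Suc k) = ?N (z (Suc k))" using all by blast
  next
    assume iter: "\<forall>k. x (Suc k) = ?N (z (Suc k))"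
    have all: "x k = ?N (z k)" for k using iter start by (cases k) simp_all
    have "x (Suc k) + ?Y (x (Suc k)) = z (Suc k)" for k using all N_iff by metis
    then show ?rec using halpern all by simp
  qed
  finally show ?thesis .
qed

end
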